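(* Let $d\in\mathbb N$, $0<r\le1$, and let $A\in\mathcal B(\ell^2(\mathbb Z^d))$ have matrix entries satisfying $|A(k,l)|\le Ce^{-\gamma|k-l|^r}$ for constants $C,\gamma>0$ and all $k,l\in\mathbb Z^d$. If $A$ is invertible in $\mathcal B(\ell^2(\mathbb Z^d))$, then there exist constants $C',\gamma'>0$ such that $$|A^{-1}(k,l)|\le C'e^{-\gamma'|k-l|^r}\qquad\text{for all }k,l\in\mathbb Z^d.$$
   Context: $\mathcal B(\ell^2(\mathbb Z^d))$ is the algebra of bounded operators on $\ell^2(\mathbb Z^d)$; operators are identified with their matrices with respect to the standard basis. $|\cdot|$ on $\mathbb Z^d$ is a fixed norm on $\mathbb R^d$ (e.g. the Euclidean norm). *)

theory Defs
  imports "HOL-Analysis.Analysis"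
begin

typedef 'a ell2 = "{x :: 'a \<Rightarrow> complex. (\<lambda>i. (cmod (x i))\<^sup>2) summable_on UNIV}"
  morphisms coord Abs_ell2
  by (rule exI[of _ "\<lambda>_. 0"]) auto

setup_lifting type_definition_ell2

lemma coord_summable: "(\<lambda>i. (cmod (coord x i))\<^sup>2) summable_on UNIV"
  using coord[of x] by simp

lemma ell2_eqI: "(\<And>i. coord x i = coord y i) \<Longrightarrow> x = y"
  by (simp add: coord_inject[symmetric] fun_eq_iff)

lemma square_summable_add:
  assumes "(\<lambda>i. (cmod (x i))\<^sup>2) summable_on UNIV" "(\<lambda>i. (cmod (y i))\<^sup>2) summable_on UNIV"
  shows "(\<lambda>i. (cmod (x i + y i))\<^sup>2) summable_on UNIV"
proof (rule summable_on_comparison_test)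
  show "(\<lambda>i. 2 * (cmod (x i))\<^sup>2 + 2 * (cmod (y i))\<^sup>2) summable_on UNIV"
    by (intro summable_on_add summable_on_cmult_right assms)
  fix i
  have "(cmod (x i + y i))\<^sup>2 \<le> (cmod (x i) + cmod (y i))\<^sup>2"
    by (intro power_mono norm_triangle_ineq) auto
  also have "\<dots> \<le> 2 * (cmod (x i))\<^sup>2 + 2 * (cmod (y i))\<^sup>2"
    using zero_le_power2[of "cmod (x i) - cmod (y i)"]
    by (simp add: power2_eq_square algebra_simps)
  finally show "(cmod (x i + y i))\<^sup>2 \<le> 2 * (cmod (x i))\<^sup>2 + 2 * (cmod (y i))\<^sup>2" .
qed auto

lemma square_summable_mult:
  assumes "(\<lambda>i. (cmod (x i))\<^sup>2) summable_on UNIV"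
  shows "(\<lambda>i. (cmod (c * x i))\<^sup>2) summable_on UNIV"
  unfolding norm_mult power_mult_distrib by (intro summable_on_cmult_right assms)

instantiation ell2 :: (type) real_normed_vector
begin

lift_definition zero_ell2 :: "'a ell2" is "\<lambda>_. 0" by simp

lift_definition plus_ell2 :: "'a ell2 \<Rightarrow> 'a ell2 \<Rightarrow> 'a ell2" is "\<lambda>x y i. x i + y i"
  by (rule square_summable_add)

lift_definition uminus_ell2 :: "'a ell2 \<Rightarrow> 'a ell2" is "\<lambda>x i. - x i" by simp

lift_definition minus_ell2 :: "'a ell2 \<Rightarrow> 'a ell2 \<Rightarrow> 'a ell2" is "\<lambda>x y i. x i - y i"
  subgoal for x y using square_summable_add[of x "\<lambda>i. - y i"] by simp
  done

lift_definition scaleR_ell2 :: "real \<Rightarrow> 'a ell2 \<Rightarrow> 'a ell2" is "\<lambda>a x i. complex_of_real a * x i"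
  by (rule square_summable_mult)

definition norm_ell2 :: "'a ell2 \<Rightarrow> real"
  where "norm_ell2 x = sqrt (\<Sum>\<^sub>\<infinity>i. (cmod (coord x i))\<^sup>2)"

definition dist_ell2 :: "'a ell2 \<Rightarrow> 'a ell2 \<Rightarrow> real"
  where "dist_ell2 x y = norm (x - y)"

definition sgn_ell2 :: "'a ell2 \<Rightarrow> 'a ell2"
  where "sgn_ell2 x = inverse (norm x) *\<^sub>R x"

definition uniformity_ell2 :: "('a ell2 \<times> 'a ell2) filter"
  where "uniformity_ell2 = (INF e\<in>{0<..}. principal {(x, y). dist x y < e})"

definition open_ell2 :: "'a ell2 set \<Rightarrow> bool"
  where "open_ell2 U \<longleftrightarrow> (\<forall>x\<in>U. eventually (\<lambda>(x', y). x' = x \<longrightarrow> y \<in> U) uniformity)"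

instance
proof
  fix x y z :: "'a ell2" and a b :: real
  show "x + y + z = x + (y + z)" "x + y = y + x" "0 + x = x" "- x + x = 0" "x - y = x + - y"
    by (transfer, simp add: algebra_simps)+
  show "a *\<^sub>R (x + y) = a *\<^sub>R x + a *\<^sub>R y" "(a + b) *\<^sub>R x = a *\<^sub>R x + b *\<^sub>R x"
    "a *\<^sub>R b *\<^sub>R x = (a * b) *\<^sub>R x" "1 *\<^sub>R x = x"
    by (transfer, simp add: algebra_simps)+
  show "dist x y = norm (x - y)" by (rule dist_ell2_def)
  show "sgn x = inverse (norm x) *\<^sub>R x" by (rule sgn_ell2_def)
  show "(uniformity :: ('a ell2 \<times> 'a ell2) filter) = (INF e\<in>{0<..}. principal {(x, y). dist x y < e})"
    by (rule uniformity_ell2_def)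
  show "open U \<longleftrightarrow> (\<forall>x\<in>U. eventually (\<lambda>(x', y). x' = x \<longrightarrow> y \<in> U) uniformity)" for U :: "'a ell2 set"
    by (rule open_ell2_def)
  show "norm x = 0 \<longleftrightarrow> x = 0"
  proof
    assume "norm x = 0"
    then have "(\<Sum>\<^sub>\<infinity>i. (cmod (coord x i))\<^sup>2) = 0" by (simp add: norm_ell2_def)
    then have "(cmod (coord x i))\<^sup>2 = 0" for i
      using nonneg_infsum_le_0D[OF _ coord_summable[of x]] by auto
    then show "x = 0" by (intro ell2_eqI) (simp add: zero_ell2.rep_eq)
  qed (simp add: norm_ell2_def zero_ell2.rep_eq)
  show "norm (a *\<^sub>R x) = \<bar>a\<bar> * norm x"
    by (simp add: norm_ell2_def scaleR_ell2.rep_eq norm_mult power_mult_distrib infsum_cmult_right'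
        real_sqrt_mult)
  have L2: "L2_set (\<lambda>i. cmod (coord w i)) F \<le> norm w" if "finite F" for w :: "'a ell2" and F
    unfolding L2_set_def norm_ell2_def
    by (intro real_sqrt_le_mono finite_sum_le_infsum coord_summable that) auto
  have "(\<Sum>\<^sub>\<infinity>i. (cmod (coord (x + y) i))\<^sup>2) \<le> (norm x + norm y)\<^sup>2"
  proof (rule infsum_le_finite_sums[OF coord_summable])
    fix F :: "'a set" assume F: "finite F"
    have "L2_set (\<lambda>i. cmod (coord (x + y) i)) F
        \<le> L2_set (\<lambda>i. cmod (coord x i) + cmod (coord y i)) F"
      by (intro L2_set_mono) (auto simp: plus_ell2.rep_eq norm_triangle_ineq)
    also have "\<dots> \<le> norm x + norm y"
      using L2_set_triangle_ineq[of "\<lambda>i. cmod (coord x i)" "\<lambda>i. cmod (coord y i)" F]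
        L2[OF F, of x] L2[OF F, of y] by linarith
    finally show "(\<Sum>i\<in>F. (cmod (coord (x + y) i))\<^sup>2) \<le> (norm x + norm y)\<^sup>2"
      unfolding L2_set_def by (rule sqrt_le_D)
  qed
  moreover have "0 \<le> norm x + norm y"
    by (simp add: norm_ell2_def infsum_nonneg)
  ultimately show "norm (x + y) \<le> norm x + norm y"
    unfolding norm_ell2_def[of "x + y"] by (intro real_le_lsqrt) auto
qed

end

lift_definition scaleC :: "complex \<Rightarrow> 'a ell2 \<Rightarrow> 'a ell2" (infixr "*\<^sub>C" 75) is "\<lambda>c x i. c * x i"
  by (rule square_summable_mult)

lift_definition unit_vec :: "'a \<Rightarrow> 'a ell2" is "\<lambda>k i. if i = k then 1 else 0"
  subgoal for k
    by (rule finite_nonzero_values_imp_summable_on) (auto intro: finite_subset[of _ "{k}"])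
  done

text \<open>The library's \<^const>\<open>bounded_linear\<close> only asks for linearity over the reals.\<close>

definition bounded_op :: "('a ell2 \<Rightarrow> 'a ell2) \<Rightarrow> bool"
  where "bounded_op A \<longleftrightarrow> bounded_linear A \<and> (\<forall>c x. A (c *\<^sub>C x) = c *\<^sub>C A x)"

text \<open>Invertibility in the algebra of bounded operators. The inverse is then unique and equals
  the function inverse \<^term>\<open>inv A\<close>.\<close>

definition invertible_op :: "('a ell2 \<Rightarrow> 'a ell2) \<Rightarrow> bool"
  where "invertible_op A \<longleftrightarrow> bounded_op A \<and> (\<exists>B. bounded_op B \<and> A \<circ> B = id \<and> B \<circ> A = id)"

lemma inv_eq_inverse_op: "A \<circ> B = id \<Longrightarrow> B \<circ> A = id \<Longrightarrow> inv A = B"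
  by (rule inv_unique_comp)

definition mat_entry :: "('a ell2 \<Rightarrow> 'a ell2) \<Rightarrow> 'a \<Rightarrow> 'a \<Rightarrow> complex"
  where "mat_entry A k l = coord (A (unit_vec l)) k"

definition is_norm :: "('v::real_vector \<Rightarrow> real) \<Rightarrow> bool"
  where "is_norm N \<longleftrightarrow> (\<forall>x. 0 \<le> N x) \<and> (\<forall>x. N x = 0 \<longleftrightarrow> x = 0) \<and>
    (\<forall>a x. N (a *\<^sub>R x) = \<bar>a\<bar> * N x) \<and> (\<forall>x y. N (x + y) \<le> N x + N y)"

definition lattice_vec :: "int ^ 'd \<Rightarrow> real ^ 'd"
  where "lattice_vec k = (\<chi> i. real_of_int (k $ i))"

end

theory Submission
  imports Defs
begin

text \<open>
  Since \<open>r \<le> 1\<close>, \<open>\<rho>(k, l) = N(k - l)\<^sup>r\<close> is itself a metric, so the Combes--Thomas argument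
  applies. Fix \<open>k\<close>, \<open>l\<close> and let \<open>\<phi>(i) = min (\<rho>(i, l)) (\<rho>(k, l))\<close>, a bounded function that
  is 1-Lipschitz for \<open>\<rho>\<close>. By Schur's test the conjugate \<open>exp(\<epsilon>\<phi>) A exp(-\<epsilon>\<phi>)\<close> differs from \<open>A\<close> by an
  operator of norm \<open>O(\<epsilon>)\<close>, uniformly in \<open>k\<close> and \<open>l\<close>. For small \<open>\<epsilon>\<close> it is therefore bounded below,
  so the vector \<open>exp(\<epsilon>\<phi>) A\<^sup>-\<^sup>1 e\<^sub>l\<close>, which it maps to \<open>e\<^sub>l\<close>, has norm at most
  \<open>2 \<parallel>A\<^sup>-\<^sup>1\<parallel>\<close>; its \<open>k\<close>-th coordinate is \<open>exp(\<epsilon> \<rho>(k, l))\<close> times the entry of \<open>A\<^sup>-\<^sup>1\<close>.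
\<close>

section \<open>Norm, coordinates and matrix action on ell2\<close>

lemma norm_ell2_squared: "(norm x)\<^sup>2 = (\<Sum>\<^sub>\<infinity>i. (cmod (coord x i))\<^sup>2)"
  by (simp add: norm_ell2_def infsum_nonneg)

lemma sum_coord_le_norm:
  assumes "finite F"
  shows "(\<Sum>i\<in>F. (cmod (coord x i))\<^sup>2) \<le> (norm x)\<^sup>2"
  unfolding norm_ell2_squared by (intro finite_sum_le_infsum coord_summable assms) auto

lemma norm_ell2_leI:
  assumes "0 \<le> c" and "\<And>F. finite F \<Longrightarrow> (\<Sum>i\<in>F. (cmod (coord x i))\<^sup>2) \<le> c\<^sup>2"
  shows "norm x \<le> c"
proof -
  have "(norm x)\<^sup>2 \<le> c\<^sup>2"
    unfolding norm_ell2_squared by (rule infsum_le_finite_sums[OF coord_summable assms(2)])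
  then show ?thesis using assms(1) by (rule power2_le_imp_le)
qed

lemma cmod_coord_le_norm: "cmod (coord x i) \<le> norm x"
  using sum_coord_le_norm[of "{i}" x] by (intro power2_le_imp_le[OF _ norm_ge_zero]) simp

lemma bounded_linear_coord: "bounded_linear (\<lambda>x. coord x i)"
proof (rule bounded_linear_intro[of _ 1])
  show "norm (coord x i) \<le> norm x * 1" for x :: "'a ell2"
    using cmod_coord_le_norm[of x i] by simp
qed (simp_all add: plus_ell2.rep_eq scaleR_ell2.rep_eq scaleR_conv_of_real)

lemma norm_unit_vec_le: "norm (unit_vec k) \<le> 1"
proof (rule norm_ell2_leI)
  fix F :: "'a set" assume F: "finite F"
  have "(\<Sum>i\<in>F. (cmod (coord (unit_vec k) i))\<^sup>2) = (\<Sum>i\<in>F. if i = k then 1 else 0)"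
    by (intro sum.cong) (auto simp: unit_vec.rep_eq)
  also have "\<dots> \<le> 1" using F by simp
  finally show "(\<Sum>i\<in>F. (cmod (coord (unit_vec k) i))\<^sup>2) \<le> 1\<^sup>2" by simp
qed simp

lemma coord_sum: "coord (\<Sum>j\<in>F. f j) i = (\<Sum>j\<in>F. coord (f j) i)"
  by (induction F rule: infinite_finite_induct) (simp_all add: plus_ell2.rep_eq zero_ell2.rep_eq)

text \<open>The error of the partial sum over \<open>F\<close> is, up to sign, the part of
  \<open>x\<close> off \<open>F\<close>. Its squared norm is what the sum of squares over
  \<open>F\<close> still lacks.\<close>

lemma has_sum_unit_vec: "((\<lambda>j. coord x j *\<^sub>C unit_vec j) has_sum x) UNIV"
  unfolding has_sum_def
proof (rule tendstoI)
  fix e :: real assume e: "0 < e"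
  let ?P = "\<lambda>F. \<Sum>j\<in>F. coord x j *\<^sub>C unit_vec j"
  have "((\<lambda>F. \<Sum>i\<in>F. (cmod (coord x i))\<^sup>2) \<longlongrightarrow> (norm x)\<^sup>2) (finite_subsets_at_top UNIV)"
    using has_sum_infsum[OF coord_summable[of x]] unfolding norm_ell2_squared has_sum_def .
  \<comment> \<open>A defect below (e/2)^2 bounds the tail in norm by e/2, hence strictly by
    \<open>e\<close>.\<close>
  then have "\<forall>\<^sub>F F in finite_subsets_at_top UNIV.
      (norm x)\<^sup>2 - (e/2)\<^sup>2 < (\<Sum>i\<in>F. (cmod (coord x i))\<^sup>2)"
    using e by (intro order_tendstoD) auto
  moreover have "\<forall>\<^sub>F F in finite_subsets_at_top UNIV. finite (F :: 'a set)"
    by (rule eventually_finite_subsets_at_top_weakI)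
  ultimately show "\<forall>\<^sub>F F in finite_subsets_at_top UNIV. dist (?P F) x < e"
  proof eventually_elim
    case (elim F)
    have co: "coord (?P F - x) i = (if i \<in> F then 0 else - coord x i)" for i
    proof -
      have "coord (?P F) i = (\<Sum>j\<in>F. if i = j then coord x j else 0)"
        unfolding coord_sum scaleC.rep_eq unit_vec.rep_eq by (intro sum.cong) auto
      also have "\<dots> = (if i \<in> F then coord x i else 0)" using elim by simp
      finally show ?thesis by (auto simp: minus_ell2.rep_eq)
    qed
    have "norm (?P F - x) \<le> e/2"
    proof (rule norm_ell2_leI)
      fix G :: "'a set" assume G: "finite G"
      have "(\<Sum>i\<in>G. (cmod (coord (?P F - x) i))\<^sup>2) = (\<Sum>i\<in>G-F. (cmod (coord x i))\<^sup>2)"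
        unfolding co using G by (intro sum.mono_neutral_cong_right) auto
      also have "\<dots> + (\<Sum>i\<in>F. (cmod (coord x i))\<^sup>2) = (\<Sum>i\<in>G\<union>F. (cmod (coord x i))\<^sup>2)"
        using G elim by (subst sum.union_disjoint[symmetric]) auto
      also have "\<dots> \<le> (norm x)\<^sup>2" using G elim by (intro sum_coord_le_norm) auto
      finally show "(\<Sum>i\<in>G. (cmod (coord (?P F - x) i))\<^sup>2) \<le> (e/2)\<^sup>2" using elim by linarith
    qed (use e in simp)
    then show ?case using e by (simp add: dist_norm)
  qed
qed

text \<open>Each coordinate of \<open>A x\<close> depends continuously and linearly on
  \<open>x\<close>, so it may be applied termwise to the unit vector expansion. Complex homogeneity
  then extracts \<open>coord x j\<close>.\<close>

lemma has_sum_mat_entry: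
  assumes "bounded_op A"
  shows "((\<lambda>j. mat_entry A i j * coord x j) has_sum coord (A x) i) UNIV"
proof -
  have bl: "bounded_linear (\<lambda>x. coord (A x) i)"
    by (rule bounded_linear_compose[OF bounded_linear_coord, where g = A])
      (use assms in \<open>simp add: bounded_op_def\<close>)
  have "coord (A (c *\<^sub>C y)) i = c * coord (A y) i" for c y
    using assms by (simp add: bounded_op_def scaleC.rep_eq)
  then show ?thesis
    using has_sum_bounded_linear[OF bl has_sum_unit_vec[of x]] by (simp add: mat_entry_def mult.commute o_def)
qed

section \<open>Schur's test\<close>

lemma sum_squared_le_weighted:
  fixes w x :: "'a \<Rightarrow> real"
  assumes "\<And>j. 0 \<le> w j"
  shows "(\<Sum>j\<in>G. w j * x j)\<^sup>2 \<le> (\<Sum>j\<in>G. w j) * (\<Sum>j\<in>G. w j * (x j)\<^sup>2)"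
  using Cauchy_Schwarz_ineq_sum[of "\<lambda>j. sqrt (w j)" "\<lambda>j. sqrt (w j) * x j" G] assms
  by (simp add: power_mult_distrib mult.assoc[symmetric])

text \<open>Only two vectors linked by the matrix series appear, so no bounded operator with matrix
  \<open>M\<close> has to be constructed. Weighted Cauchy-Schwarz uses the row bound, exchanging the
  sums uses the column bound, and each contributes one factor \<open>S\<close> to the squared
  norm.\<close>

lemma schur_test:
  fixes M :: "'a \<Rightarrow> 'a \<Rightarrow> complex" and K :: "'a \<Rightarrow> 'a \<Rightarrow> real"
  assumes M: "\<And>i j. cmod (M i j) \<le> K i j"
    and rows: "\<And>i G. finite G \<Longrightarrow> (\<Sum>j\<in>G. K i j) \<le> S"
    and cols: "\<And>j F. finite F \<Longrightarrow> (\<Sum>i\<in>F. K i j) \<le> S"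
    and y: "\<And>i. ((\<lambda>j. M i j * coord x j) has_sum coord y i) UNIV"
  shows "norm y \<le> S * norm x"
proof (rule norm_ell2_leI)
  have S: "0 \<le> S" using rows[of "{}"] by simp
  then show "0 \<le> S * norm x" by simp
  have K: "0 \<le> K i j" for i j by (rule order_trans[OF norm_ge_zero M])
  fix F :: "'a set" assume F: "finite F"
  have bound: "(\<Sum>i\<in>F. (cmod (\<Sum>j\<in>G. M i j * coord x j))\<^sup>2) \<le> (S * norm x)\<^sup>2"
    if G: "finite G" for G
  proof -
    have "(cmod (\<Sum>j\<in>G. M i j * coord x j))\<^sup>2 \<le> S * (\<Sum>j\<in>G. K i j * (cmod (coord x j))\<^sup>2)" for i
    proof -
      have "cmod (\<Sum>j\<in>G. M i j * coord x j) \<le> (\<Sum>j\<in>G. K i j * cmod (coord x j))"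
        by (intro sum_norm_le) (simp add: norm_mult M mult_right_mono)
      then have "(cmod (\<Sum>j\<in>G. M i j * coord x j))\<^sup>2 \<le> (\<Sum>j\<in>G. K i j * cmod (coord x j))\<^sup>2"
        by (intro power_mono) auto
      also have "\<dots> \<le> (\<Sum>j\<in>G. K i j) * (\<Sum>j\<in>G. K i j * (cmod (coord x j))\<^sup>2)"
        by (intro sum_squared_le_weighted K)
      also have "\<dots> \<le> S * (\<Sum>j\<in>G. K i j * (cmod (coord x j))\<^sup>2)"
        by (intro mult_right_mono rows G sum_nonneg) (simp add: K)
      finally show ?thesis .
    qed
    then have "(\<Sum>i\<in>F. (cmod (\<Sum>j\<in>G. M i j * coord x j))\<^sup>2)
        \<le> (\<Sum>i\<in>F. S * (\<Sum>j\<in>G. K i j * (cmod (coord x j))\<^sup>2))"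
      by (intro sum_mono)
    also have "\<dots> = S * (\<Sum>j\<in>G. (\<Sum>i\<in>F. K i j) * (cmod (coord x j))\<^sup>2)"
      unfolding sum_distrib_left[symmetric] sum_distrib_right by (subst sum.swap) rule
    also have "\<dots> \<le> S * (\<Sum>j\<in>G. S * (cmod (coord x j))\<^sup>2)"
      by (intro mult_left_mono sum_mono mult_right_mono cols F S) auto
    also have "\<dots> = S\<^sup>2 * (\<Sum>j\<in>G. (cmod (coord x j))\<^sup>2)"
      by (simp add: sum_distrib_left power2_eq_square mult.assoc)
    also have "\<dots> \<le> S\<^sup>2 * (norm x)\<^sup>2" by (intro mult_left_mono sum_coord_le_norm G) auto
    finally show ?thesis by (simp add: power_mult_distrib)
  qed
  \<comment> \<open>\<open>F\<close> stays fixed and finite, so the bound for truncated rows,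
    uniform in \<open>G\<close>, survives the limit over \<open>G\<close>.\<close>
  have "((\<lambda>G. \<Sum>i\<in>F. (cmod (\<Sum>j\<in>G. M i j * coord x j))\<^sup>2) \<longlongrightarrow> (\<Sum>i\<in>F. (cmod (coord y i))\<^sup>2))
      (finite_subsets_at_top UNIV)"
    using y unfolding has_sum_def by (intro tendsto_intros)
  then show "(\<Sum>i\<in>F. (cmod (coord y i))\<^sup>2) \<le> (S * norm x)\<^sup>2"
    by (rule tendsto_upperbound)
      (auto intro: bound eventually_finite_subsets_at_top_weakI)
qed

section \<open>Exponential weights and the Combes-Thomas estimate\<close>

lemma diagonal_op:
  assumes "\<And>i. cmod (f i) \<le> c"
  shows "\<exists>y. \<forall>i. coord y i = f i * coord x i"
proof -
  have "(\<lambda>i. (cmod (f i * coord x i))\<^sup>2) summable_on UNIV"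
  proof (rule summable_on_comparison_test)
    show "(\<lambda>i. c\<^sup>2 * (cmod (coord x i))\<^sup>2) summable_on UNIV"
      by (intro summable_on_cmult_right coord_summable)
    show "(cmod (f i * coord x i))\<^sup>2 \<le> c\<^sup>2 * (cmod (coord x i))\<^sup>2" for i
      unfolding norm_mult power_mult_distrib by (intro mult_right_mono power_mono assms) auto
  qed auto
  then show ?thesis by (intro exI[of _ "Abs_ell2 (\<lambda>i. f i * coord x i)"]) (simp add: Abs_ell2_inverse)
qed

text \<open>Convexity of \<open>exp\<close> between 0 and \<open>u\<close>. It gains the small
  factor \<theta> at the price of the full exponential of \<open>u\<close>.\<close>

lemma exp_scaled_minus_one_le:
  fixes u :: real
  assumes "0 \<le> \<theta>" "\<theta> \<le> 1"
  shows "exp (\<theta> * u) - 1 \<le> \<theta> * exp u"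
proof -
  have "exp ((1 - \<theta>) *\<^sub>R 0 + \<theta> *\<^sub>R u) \<le> (1 - \<theta>) * exp 0 + \<theta> * exp u"
    using assms by (intro convex_onD[OF exp_convex]) auto
  then show ?thesis using assms by simp
qed

text \<open>The decay rate is split in half: one half absorbs the growth of the conjugating weight,
  the other stays summable for Schur's test. The bound \<open>S\<close> is uniform in
  \<open>i\<close>, and by symmetry of \<rho> it serves rows and columns alike.\<close>

lemma combes_thomas:
  fixes A B :: "'a ell2 \<Rightarrow> 'a ell2" and \<rho> :: "'a \<Rightarrow> 'a \<Rightarrow> real"
  assumes \<rho>: "\<And>i. \<rho> i i = 0" "\<And>i j. \<rho> i j = \<rho> j i" "\<And>i j k. \<rho> i k \<le> \<rho> i j + \<rho> j k"
    and C: "0 < C" and \<gamma>: "0 < \<gamma>"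
    and S: "\<And>i F. finite F \<Longrightarrow> (\<Sum>j\<in>F. exp (- (\<gamma> / 2) * \<rho> i j)) \<le> S"
    and A: "bounded_op A" "\<And>i j. cmod (mat_entry A i j) \<le> C * exp (- \<gamma> * \<rho> i j)"
    and B: "bounded_op B" "A \<circ> B = id" "B \<circ> A = id"
  shows "\<exists>C'>0. \<exists>\<gamma>'>0. \<forall>k l. cmod (mat_entry B k l) \<le> C' * exp (- \<gamma>' * \<rho> k l)"
proof -
  have \<rho>0: "0 \<le> \<rho> i j" for i j using \<rho>(1)[of i] \<rho>(2)[of i j] \<rho>(3)[of i i j] by linarith
  obtain \<beta> where \<beta>: "0 < \<beta>" "norm (B x) \<le> norm x * \<beta>" for x
    using bounded_linear.pos_bounded B(1) unfolding bounded_op_def by blast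
  \<comment> \<open>The diagonal term is exp 0 = 1; dividing by \<open>S\<close> below is therefore
    sound.\<close>
  have S1: "1 \<le> S" using S[of "{undefined}" undefined] \<rho>(1) by simp
  \<comment> \<open>The cap 1 permits the convexity estimate. The quotient makes \<beta> times the
    Schur bound at most 1/2, so that the perturbation can be absorbed.\<close>
  define \<theta> where "\<theta> = min 1 (1 / (2 * \<beta> * C * S))"
  have \<theta>: "0 < \<theta>" "\<theta> \<le> 1" using \<beta>(1) C S1 by (auto simp: \<theta>_def)
  have "\<theta> \<le> 1 / (2 * \<beta> * C * S)" by (simp add: \<theta>_def)
  then have \<theta>\<beta>: "\<beta> * (\<theta> * C * S) \<le> 1 / 2" using \<beta>(1) C S1 by (simp add: field_simps)
  define \<epsilon> where "\<epsilon> = \<theta> * (\<gamma> / 2)"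
  have \<epsilon>: "0 < \<epsilon>" using \<theta> \<gamma> by (simp add: \<epsilon>_def)
  have "cmod (mat_entry B k l) \<le> 2 * \<beta> * exp (- \<epsilon> * \<rho> k l)" for k l
  proof -
    \<comment> \<open>The cap \<open>\<rho> k l\<close> keeps the weight bounded, so that the
      weighted vector \<open>z\<close> stays in ell2, yet leaves its full value at
      \<open>k\<close>.\<close>
    define \<phi> where "\<phi> i = min (\<rho> i l) (\<rho> k l)" for i
    define f where "f i = exp (\<epsilon> * \<phi> i)" for i
    have \<phi>l: "\<phi> l = 0" using \<rho>(1) \<rho>0 by (simp add: \<phi>_def)
    have \<phi>d: "\<bar>\<phi> i - \<phi> j\<bar> \<le> \<rho> i j" for i j
      using \<rho>(3)[of i l j] \<rho>(3)[of j l i] \<rho>(2)[of i j] \<rho>0[of i j] by (auto simp: \<phi>_def min_def)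
    have "cmod (complex_of_real (f i)) \<le> exp (\<epsilon> * \<rho> k l)" for i
      using \<epsilon> by (simp add: f_def \<phi>_def)
    from diagonal_op[where f = "\<lambda>i. complex_of_real (f i)", OF this, where x = "B (unit_vec l)"]
    obtain z where z: "\<And>i. coord z i = f i * coord (B (unit_vec l)) i" by auto
    have AB: "A (B (unit_vec l)) = unit_vec l" using B(2) by (metis comp_apply id_apply)
    \<comment> \<open>With b = \<open>B (unit_vec l)\<close>, the difference is the commutator of
      \<open>A\<close> with the weight: the sum over j of A_ij (f_j - f_i) b_j. Since z_j = f_j b_j,
      its kernel acting on \<open>z\<close> is A_ij (1 - f_i / f_j).\<close>
    have "norm (A z - unit_vec l) \<le> (\<theta> * C * S) * norm z"
    proof (rule schur_test)
      let ?M = "\<lambda>i j. mat_entry A i j * of_real (1 - exp (\<epsilon> * (\<phi> i - \<phi> j)))"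
      let ?K = "\<lambda>i j. \<theta> * C * exp (- (\<gamma> / 2) * \<rho> i j)"
      show "cmod (?M i j) \<le> ?K i j" for i j
      proof -
        \<comment> \<open>For negative \<open>t\<close> this says that exp t + exp (-t) is at least
          2. It allows the Lipschitz bound on \<phi> to be used whatever the sign.\<close>
        have "\<bar>1 - exp t\<bar> \<le> exp \<bar>t\<bar> - 1" for t :: real
        proof (cases "0 \<le> t")
          case False
          then have "2 \<le> exp t + exp (- t)"
            using exp_ge_add_one_self[of t] exp_ge_add_one_self[of "-t"] by linarith
          with False show ?thesis by simp
        qed simp
        from this[of "\<epsilon> * (\<phi> i - \<phi> j)"]
        have "\<bar>1 - exp (\<epsilon> * (\<phi> i - \<phi> j))\<bar> \<le> exp (\<epsilon> * \<bar>\<phi> i - \<phi> j\<bar>) - 1"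
          using \<epsilon> by (simp add: abs_mult)
        also have "\<dots> \<le> exp (\<theta> * (\<gamma> / 2 * \<rho> i j)) - 1"
          using mult_left_mono[OF \<phi>d[of i j], of \<epsilon>] \<epsilon> by (simp add: \<epsilon>_def mult.assoc)
        also have "\<dots> \<le> \<theta> * exp (\<gamma> / 2 * \<rho> i j)"
          using \<theta> by (intro exp_scaled_minus_one_le) auto
        finally have "cmod (?M i j) \<le> (C * exp (- \<gamma> * \<rho> i j)) * (\<theta> * exp (\<gamma> / 2 * \<rho> i j))"
          unfolding norm_mult norm_of_real using C by (intro mult_mono A) auto
        also have "\<dots> = \<theta> * C * (exp (- \<gamma> * \<rho> i j) * exp (\<gamma> / 2 * \<rho> i j))" by simp
        also have "\<dots> = ?K i j" unfolding exp_add[symmetric] by (simp add: field_simps)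
        finally show ?thesis .
      qed
      show row: "(\<Sum>j\<in>G. ?K i j) \<le> \<theta> * C * S" if "finite G" for i G
        unfolding sum_distrib_left[symmetric] using S[OF that, of i] \<theta> C by (intro mult_left_mono) auto
      show "(\<Sum>i\<in>F. ?K i j) \<le> \<theta> * C * S" if "finite F" for j F
        using row[OF that, of j] by (simp only: \<rho>(2)[of _ j])
      show "((\<lambda>j. ?M i j * coord z j) has_sum coord (A z - unit_vec l) i) UNIV" for i
      proof -
        have "((\<lambda>j. mat_entry A i j * coord z j + (- of_real (f i)) * (mat_entry A i j * coord (B (unit_vec l)) j))
            has_sum (coord (A z) i + (- of_real (f i)) * coord (A (B (unit_vec l))) i)) UNIV"
          by (intro has_sum_add has_sum_cmult_right has_sum_mat_entry A(1))
        \<comment> \<open>The weight leaves \<open>unit_vec l\<close> unchanged, because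
          \<open>f l\<close> is exp 0 = 1.\<close>
        moreover have "coord (A z) i + (- of_real (f i)) * coord (A (B (unit_vec l))) i = coord (A z - unit_vec l) i"
          unfolding AB by (simp add: minus_ell2.rep_eq unit_vec.rep_eq f_def \<phi>l)
        moreover have "mat_entry A i j * coord z j + (- of_real (f i)) * (mat_entry A i j * coord (B (unit_vec l)) j)
            = ?M i j * coord z j" for j
        proof -
          have "f i = exp (\<epsilon> * (\<phi> i - \<phi> j)) * f j"
            by (simp add: f_def exp_add[symmetric] algebra_simps)
          then show ?thesis by (simp add: z algebra_simps)
        qed
        ultimately show ?thesis by simp
      qed
    qed
    \<comment> \<open>Absorption: \<open>z\<close> is recovered from \<open>A z\<close> by
      \<open>B\<close>, so its norm is at most \<beta> plus half of itself.\<close>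
    then have "norm (A z) \<le> 1 + (\<theta> * C * S) * norm z"
      using norm_unit_vec_le[of l] norm_triangle_sub[of "A z" "unit_vec l"] by linarith
    then have "\<beta> * norm (A z) \<le> \<beta> * (1 + (\<theta> * C * S) * norm z)" using \<beta>(1) by simp
    also have "\<dots> = \<beta> + \<beta> * (\<theta> * C * S) * norm z" by (simp add: algebra_simps)
    also have "\<dots> \<le> \<beta> + 1 / 2 * norm z" using \<theta>\<beta> by (intro add_left_mono mult_right_mono) auto
    finally have "\<beta> * norm (A z) \<le> \<beta> + 1 / 2 * norm z" .
    moreover have "norm z \<le> \<beta> * norm (A z)"
      using \<beta>(2)[of "A z"] B(3) by (metis comp_apply id_apply mult.commute)
    ultimately have "norm z \<le> 2 * \<beta>" by linarith
    \<comment> \<open>At \<open>k\<close> both arguments of the minimum agree, so the weight there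
      is the full exponential of \<epsilon> times \<open>\<rho> k l\<close>.\<close>
    with cmod_coord_le_norm[of z k] have "exp (\<epsilon> * \<rho> k l) * cmod (mat_entry B k l) \<le> 2 * \<beta>"
      by (simp add: z norm_mult f_def \<phi>_def mat_entry_def)
    then show ?thesis by (simp add: exp_minus field_simps)
  qed
  then show ?thesis using \<beta>(1) \<epsilon> by (intro exI[of _ "2 * \<beta>"] conjI exI[of _ \<epsilon>]) auto
qed

section \<open>Subadditivity of powers and summability over the lattice\<close>

text \<open>After division by a + b the two fractions lie in [0, 1], where t is at most
  \<open>t powr r\<close>, and add up to 1. This supplies the triangle inequality for powers of a
  norm.\<close>

lemma powr_add_le_add_powr:
  fixes a b r :: real
  assumes "0 \<le> a" "0 \<le> b" "0 < r" "r \<le> 1"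
  shows "(a + b) powr r \<le> a powr r + b powr r"
proof (cases "a + b = 0")
  case False
  define s where "s = a + b"
  have s: "0 < s" using False assms by (simp add: s_def)
  have t: "t \<le> t powr r" if "0 \<le> t" "t \<le> 1" for t :: real
    using powr_mono'[of r 1 t] that assms by simp
  have "s powr r * 1 = s powr r * (a / s + b / s)" using s by (simp add: s_def add_divide_distrib[symmetric])
  also have "\<dots> \<le> s powr r * ((a / s) powr r + (b / s) powr r)"
    using s assms by (intro mult_left_mono add_mono t) (auto simp: s_def)
  also have "\<dots> = a powr r + b powr r"
    using s assms by (simp add: powr_divide distrib_left)
  finally show ?thesis by (simp add: s_def)
qed (use assms in simp)

text \<open>\<open>N\<close> is Lipschitz for the Euclidean norm, so it attains a minimum on the
  compact unit sphere, positive by definiteness. Homogeneity carries the bound to all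
  vectors.\<close>

lemma is_norm_ge_norm:
  fixes N :: "'v::euclidean_space \<Rightarrow> real"
  assumes "is_norm N"
  shows "\<exists>c>0. \<forall>x. c * norm x \<le> N x"
proof -
  have N: "0 \<le> N x" "N x = 0 \<longleftrightarrow> x = 0" "N (a *\<^sub>R x) = \<bar>a\<bar> * N x" "N (x + y) \<le> N x + N y" for a x y
    using assms by (auto simp: is_norm_def)
  have Nsum: "N (\<Sum>b\<in>F. g b) \<le> (\<Sum>b\<in>F. N (g b))" for F and g :: "'v \<Rightarrow> 'v"
  proof (induction F rule: infinite_finite_induct)
    case (insert b F)
    then show ?case using N(4)[of "g b" "sum g F"] by simp
  qed (use N(2)[of 0] in simp_all)
  define L where "L = (\<Sum>b\<in>(Basis :: 'v set). N b)"
  have L: "N x \<le> L * norm x" for x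
  proof -
    have "N x = N (\<Sum>b\<in>Basis. (x \<bullet> b) *\<^sub>R b)" by (simp add: euclidean_representation)
    also have "\<dots> \<le> (\<Sum>b\<in>Basis. \<bar>x \<bullet> b\<bar> * N b)" using Nsum by (simp add: N(3)[symmetric])
    also have "\<dots> \<le> (\<Sum>b\<in>Basis. norm x * N b)"
      by (intro sum_mono mult_right_mono N(1) Basis_le_norm)
    finally show ?thesis by (simp add: L_def sum_distrib_left mult.commute)
  qed
  have diff: "N x - N y \<le> L * dist x y" for x y
    using N(4)[of y "x - y"] L[of "x - y"] by (simp add: dist_norm)
  have "L-lipschitz_on UNIV N"
  proof (rule lipschitz_onI)
    show "dist (N x) (N y) \<le> L * dist x y" for x y
      using diff[of x y] diff[of y x] by (simp add: dist_real_def dist_commute abs_le_iff)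
  qed (simp add: L_def sum_nonneg N(1))
  then have cont: "continuous_on (sphere 0 1) N"
    by (meson lipschitz_on_continuous_on continuous_on_subset subset_UNIV)
  obtain b :: 'v where "b \<in> Basis" using nonempty_Basis by blast
  then have "sphere (0::'v) 1 \<noteq> {}" by (auto intro!: exI[of _ b])
  then obtain u where u: "u \<in> sphere 0 1" "\<And>v. v \<in> sphere 0 1 \<Longrightarrow> N u \<le> N v"
    using continuous_attains_inf[OF compact_sphere _ cont] by blast
  have "N u * norm x \<le> N x" for x
  proof (cases "x = 0")
    case False
    have "N u \<le> N (inverse (norm x) *\<^sub>R x)" using False by (intro u) simp
    also have "\<dots> = N x / norm x" by (simp add: N(3) field_simps)
    finally show ?thesis using False by (simp add: field_simps)
  qed (simp add: N(1))
  moreover have "0 < N u" using N(1)[of u] N(2)[of u] u(1) by (auto simp: less_le)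
  ultimately show ?thesis by blast
qed

lemma exp_minus_powr_le_inverse_square:
  fixes a r :: real
  assumes "0 < a" "0 < r"
  shows "\<exists>D>0. \<forall>t\<ge>0. exp (- a * t powr r) \<le> D / (1 + t)\<^sup>2"
proof -
  \<comment> \<open>With r n at least 2, the \<open>n\<close>-th term of the exponential series
    alone dominates a multiple of t^2 for t > 1.\<close>
  obtain n :: nat where n: "2 / r \<le> real n" using real_arch_simple by blast
  \<comment> \<open>The summand 4 covers t <= 1, where (1 + t)^2 <= 4. The other covers t > 1, its
    factor 4 coming from 1 + t <= 2 t.\<close>
  define D where "D = 4 + 4 * fact n / a ^ n"
  have D: "4 \<le> D" "4 * fact n / a ^ n \<le> D" using assms by (auto simp: D_def)
  have "exp (- a * t powr r) \<le> D / (1 + t)\<^sup>2" if t: "0 \<le> t" for t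
  proof (cases "t \<le> 1")
    case True
    have "(1 + t)\<^sup>2 \<le> 2\<^sup>2" using t True by (intro power_mono) auto
    then have "1 \<le> D / (1 + t)\<^sup>2" using D t by (simp add: field_simps)
    moreover have "exp (- a * t powr r) \<le> 1" using assms by simp
    ultimately show ?thesis by linarith
  next
    case False
    have "t powr 2 \<le> t powr (r * real n)" using n False assms by (intro powr_mono) (auto simp: field_simps)
    then have "t\<^sup>2 \<le> (t powr r) ^ n" using False by (simp add: powr_powr[symmetric] powr_realpow)
    then have "a ^ n * t\<^sup>2 / fact n \<le> (a * t powr r) ^ n / fact n"
      using assms by (simp add: power_mult_distrib divide_right_mono)
    also have "\<dots> = (\<Sum>k\<in>{n}. (a * t powr r) ^ k /\<^sub>R fact k)" by (simp add: field_simps)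
    also have "\<dots> \<le> exp (a * t powr r)"
      unfolding exp_def using assms summable_exp_generic[of "a * t powr r"] by (intro sum_le_suminf) auto
    finally have "exp (- a * t powr r) \<le> fact n / (a ^ n * t\<^sup>2)"
      using assms False by (simp add: exp_minus field_simps)
    also have "\<dots> = 4 * fact n / a ^ n / (2 * t)\<^sup>2" by (simp add: power_mult_distrib)
    also have "\<dots> \<le> 4 * fact n / a ^ n / (1 + t)\<^sup>2"
      using assms False by (intro divide_left_mono power_mono) auto
    also have "\<dots> \<le> D / (1 + t)\<^sup>2" using D by (intro divide_right_mono) auto
    finally show ?thesis .
  qed
  then show ?thesis using D(1) by (intro exI[of _ D]) auto
qed

text \<open>The subtracted term makes the induction go through: the two new end terms together are
  at most the telescoping difference 2/(n+1) - 2/(n+2).\<close>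

lemma sum_inverse_square_int_le:
  "(\<Sum>z\<in>{- int n..int n}. 1 / (1 + \<bar>real_of_int z\<bar>)\<^sup>2) \<le> 3 - 2 / (real n + 1)"
proof (induction n)
  case (Suc n)
  have "{- int (Suc n)..int (Suc n)} = insert (int (Suc n)) (insert (- int (Suc n)) {- int n..int n})"
    by auto
  then have "(\<Sum>z\<in>{- int (Suc n)..int (Suc n)}. 1 / (1 + \<bar>real_of_int z\<bar>)\<^sup>2)
      = 2 / (real n + 2)\<^sup>2 + (\<Sum>z\<in>{- int n..int n}. 1 / (1 + \<bar>real_of_int z\<bar>)\<^sup>2)"
    by (simp add: add.commute)
  also have "\<dots> \<le> 2 / (real n + 2)\<^sup>2 + (3 - 2 / (real n + 1))" using Suc by simp
  also have "2 / (real n + 2)\<^sup>2 \<le> 2 / ((real n + 1) * (real n + 2))"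
    by (intro divide_left_mono) (auto simp: power2_eq_square)
  also have "\<dots> = 2 / (real n + 1) - 2 / (real n + 2)" by (simp add: divide_simps)
  finally show ?case by (simp add: add.commute)
qed simp

text \<open>Each summand is dominated by a product of functions of single coordinates, and over a
  box the sum of such products factorizes into one-dimensional sums.\<close>

lemma sum_exp_minus_lattice_bound:
  fixes N :: "real ^ 'd \<Rightarrow> real"
  assumes "is_norm N" "0 < a" "0 < r"
  shows "\<exists>S. \<forall>F. finite F \<longrightarrow> (\<Sum>k\<in>F. exp (- a * N (lattice_vec k) powr r)) \<le> S"
proof -
  obtain c where c: "0 < c" "\<And>x. c * norm x \<le> N x"
    using is_norm_ge_norm[OF assms(1)] by blast
  \<comment> \<open>Each coordinate is at most the Euclidean norm, whence the factor
    \<open>c powr r\<close>. Division by the dimension lets the coordinate bounds add up to one copy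
    of the exponent.\<close>
  define b where "b = a * c powr r / CARD('d)"
  have "0 < b" using assms c by (simp add: b_def)
  then obtain D where D: "0 < D" "\<And>t. 0 \<le> t \<Longrightarrow> exp (- b * t powr r) \<le> D / (1 + t)\<^sup>2"
    using exp_minus_powr_le_inverse_square[OF _ assms(3)] by blast
  define g where "g z = D / (1 + \<bar>real_of_int z\<bar>)\<^sup>2" for z
  have g0: "0 \<le> g z" for z using D by (simp add: g_def)
  have le_prod: "exp (- a * N (lattice_vec k) powr r) \<le> (\<Prod>i\<in>UNIV. g (k $ i))" for k :: "int ^ 'd"
  proof -
    have "b * \<bar>real_of_int (k $ i)\<bar> powr r \<le> a * N (lattice_vec k) powr r / CARD('d)" for i
    proof -
      have "c * \<bar>real_of_int (k $ i)\<bar> \<le> c * norm (lattice_vec k)"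
        using component_le_norm_cart[of "lattice_vec k" i] c(1) by (simp add: lattice_vec_def)
      also have "\<dots> \<le> N (lattice_vec k)" by (rule c)
      finally have "(c * \<bar>real_of_int (k $ i)\<bar>) powr r \<le> N (lattice_vec k) powr r"
        using c assms(3) by (intro powr_mono2) auto
      then show ?thesis using c(1) assms(2)
        by (simp add: b_def powr_mult divide_right_mono mult.assoc)
    qed
    then have "(\<Sum>i\<in>UNIV. b * \<bar>real_of_int (k $ i)\<bar> powr r)
        \<le> (\<Sum>i\<in>(UNIV :: 'd set). a * N (lattice_vec k) powr r / CARD('d))"
      by (intro sum_mono)
    then have "exp (- a * N (lattice_vec k) powr r) \<le> exp (\<Sum>i\<in>UNIV. - b * \<bar>real_of_int (k $ i)\<bar> powr r)"
      by (simp add: sum_negf)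
    also have "\<dots> = (\<Prod>i\<in>UNIV. exp (- b * \<bar>real_of_int (k $ i)\<bar> powr r))" by (simp add: exp_sum)
    also have "\<dots> \<le> (\<Prod>i\<in>UNIV. g (k $ i))" unfolding g_def by (intro prod_mono conjI D) auto
    finally show ?thesis .
  qed
  have "(\<Sum>k\<in>F. exp (- a * N (lattice_vec k) powr r)) \<le> (D * 3) ^ CARD('d)"
    if F: "finite F" for F :: "(int ^ 'd) set"
  proof -
    \<comment> \<open>Half the side of a cube containing \<open>F\<close>; inserting 0 keeps the
      maximum meaningful for empty \<open>F\<close>.\<close>
    define n where "n = nat (Max (insert 0 ((\<lambda>(k, i). \<bar>k $ i\<bar>) ` (F \<times> UNIV))))"
    have n: "\<bar>k $ i\<bar> \<le> int n" if "k \<in> F" for k i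
    proof -
      have "\<bar>k $ i\<bar> \<le> Max (insert 0 ((\<lambda>(k, i). \<bar>k $ i\<bar>) ` (F \<times> UNIV)))"
        using F that by (intro Max_ge) force+
      then show ?thesis unfolding n_def by linarith
    qed
    let ?P = "PiE (UNIV :: 'd set) (\<lambda>_. {- int n..int n})"
    have "F \<subseteq> vec_lambda ` ?P"
    proof
      fix k assume "k \<in> F"
      then have "vec_nth k \<in> ?P" using n[of k] by (auto simp: abs_le_iff minus_le_iff)
      then show "k \<in> vec_lambda ` ?P" by (intro image_eqI[of _ _ "vec_nth k"]) auto
    qed
    have "(\<Sum>k\<in>F. exp (- a * N (lattice_vec k) powr r)) \<le> (\<Sum>k\<in>F. \<Prod>i\<in>UNIV. g (k $ i))"
      by (intro sum_mono le_prod)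
    also have "\<dots> \<le> (\<Sum>k\<in>vec_lambda ` ?P. \<Prod>i\<in>UNIV. g (k $ i))"
      by (intro sum_mono2 \<open>F \<subseteq> _\<close> prod_nonneg g0 finite_imageI finite_PiE) auto
    also have "\<dots> = (\<Sum>h\<in>?P. \<Prod>i\<in>UNIV. g (h i))"
      by (subst sum.reindex) (auto simp: inj_on_def vec_lambda_inject)
    also have "\<dots> = (\<Prod>i\<in>(UNIV :: 'd set). \<Sum>z\<in>{- int n..int n}. g z)"
      by (subst prod_sum_PiE) auto
    also have "\<dots> \<le> (\<Prod>i\<in>(UNIV :: 'd set). D * 3)"
    proof (intro prod_mono conjI sum_nonneg g0)
      have "(\<Sum>z\<in>{- int n..int n}. g z) = D * (\<Sum>z\<in>{- int n..int n}. 1 / (1 + \<bar>real_of_int z\<bar>)\<^sup>2)"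
        by (simp add: g_def sum_distrib_left)
      also have "\<dots> \<le> D * (3 - 2 / (real n + 1))"
        using D by (intro mult_left_mono sum_inverse_square_int_le) auto
      also have "\<dots> \<le> D * 3" using D by (intro mult_left_mono) auto
      finally show "(\<Sum>z\<in>{- int n..int n}. g z) \<le> D * 3" .
    qed
    finally show ?thesis by simp
  qed
  then show ?thesis by blast
qed

section \<open>Application to the metric given by a power of the norm\<close>

theorem corollary39:
  fixes A :: "(int ^ 'd) ell2 \<Rightarrow> (int ^ 'd) ell2"
    and N :: "real ^ 'd \<Rightarrow> real"
    and r C \<gamma> :: real
  assumes "is_norm N"
    and "0 < r" and "r \<le> 1"
    and "C > 0" and "\<gamma> > 0"
    and "bounded_op A"
    and "\<And>k l. cmod (mat_entry A k l) \<le> C * exp (- \<gamma> * N (lattice_vec (k - l)) powr r)"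
    and "invertible_op A"
  shows "\<exists>C' > 0. \<exists>\<gamma>' > 0. \<forall>k l.
    cmod (mat_entry (inv A) k l) \<le> C' * exp (- \<gamma>' * N (lattice_vec (k - l)) powr r)"
proof -
  have N: "0 \<le> N x" "N x = 0 \<longleftrightarrow> x = 0" "N (a *\<^sub>R x) = \<bar>a\<bar> * N x" "N (x + y) \<le> N x + N y" for a x y
    using assms(1) by (auto simp: is_norm_def)
  have lattice_diff: "lattice_vec (k - l) = lattice_vec k - lattice_vec l" for k l :: "int ^ 'd"
    by (simp add: lattice_vec_def vec_eq_iff)
  define \<rho> where "\<rho> k l = N (lattice_vec (k - l)) powr r" for k l :: "int ^ 'd"
  obtain B where B: "bounded_op B" "A \<circ> B = id" "B \<circ> A = id"
    using assms(8) unfolding invertible_op_def by blast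
  \<comment> \<open>Summability is taken at the halved rate that \<open>combes_thomas\<close> asks
    for.\<close>
  obtain S where S: "\<And>F :: (int ^ 'd) set. finite F \<Longrightarrow> (\<Sum>k\<in>F. exp (- (\<gamma> / 2) * N (lattice_vec k) powr r)) \<le> S"
    using sum_exp_minus_lattice_bound[OF assms(1), of "\<gamma> / 2" r] assms by auto
  have "\<exists>C'>0. \<exists>\<gamma>'>0. \<forall>k l. cmod (mat_entry B k l) \<le> C' * exp (- \<gamma>' * \<rho> k l)"
  proof (rule combes_thomas[OF _ _ _ assms(4,5) _ assms(6) _ B])
    show "\<rho> i i = 0" for i using N(2)[of 0] lattice_diff[of i i] by (simp add: \<rho>_def)
    show "\<rho> i j = \<rho> j i" for i j
      using N(3)[of "-1" "lattice_vec i - lattice_vec j"] by (simp add: \<rho>_def lattice_diff)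
    show "\<rho> i k \<le> \<rho> i j + \<rho> j k" for i j k
    proof -
      have "N (lattice_vec (i - k)) \<le> N (lattice_vec (i - j)) + N (lattice_vec (j - k))"
        using N(4)[of "lattice_vec (i - j)" "lattice_vec (j - k)"] by (simp add: lattice_diff)
      then have "\<rho> i k \<le> (N (lattice_vec (i - j)) + N (lattice_vec (j - k))) powr r"
        unfolding \<rho>_def using N(1) assms(2) by (intro powr_mono2) auto
      also have "\<dots> \<le> \<rho> i j + \<rho> j k"
        unfolding \<rho>_def by (intro powr_add_le_add_powr N(1) assms(2,3))
      finally show ?thesis .
    qed
    show "(\<Sum>j\<in>F. exp (- (\<gamma> / 2) * \<rho> i j)) \<le> S" if "finite F" for i F
    proof -
      \<comment> \<open>The injective substitution of i - j for j moves the centre to the origin, so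
        \<open>S\<close> does not depend on \<open>i\<close>.\<close>
      have "(\<Sum>j\<in>F. exp (- (\<gamma> / 2) * \<rho> i j))
          = (\<Sum>k\<in>(\<lambda>j. i - j) ` F. exp (- (\<gamma> / 2) * N (lattice_vec k) powr r))"
        by (subst sum.reindex) (auto simp: inj_on_def \<rho>_def)
      also have "\<dots> \<le> S" using that by (intro S) auto
      finally show ?thesis .
    qed
    show "cmod (mat_entry A i j) \<le> C * exp (- \<gamma> * \<rho> i j)" for i j
      unfolding \<rho>_def by (rule assms(7))
  qed
  then show ?thesis by (simp add: \<rho>_def inv_eq_inverse_op[OF B(2,3)])
qed

end
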